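(* Let $\mathbb{F}$ be a field of characteristic $0$, let $Z=\{P_1,\dots,P_r\}$ be a set of $r$ distinct points in $\mathbb{P}^n$ over $\mathbb{F}$, and let $d,m$ be positive integers with $\binom{d+n}{n}=\binom{m+n-1}{n}+r+1$. Let $F(a_0,\dots,a_n,x_0,\dots,x_n)=\det M$, where $M$ is the interpolation matrix of $(Z,d,m)$. Let $B=(b_0,\dots,b_n)\in\mathbb{P}^n$ be a point. For $1\le j\le m$ let $L_j=[I(jB)\cap I(Z)]_d$ be the $\mathbb{F}$-vector space of forms of degree $d$ in $n+1$ variables vanishing at $B$ with multiplicity at least $j$ and vanishing at every point of $Z$, and put $$k_j=\max\left(0,\ \dim L_j-\left(\binom{d+n}{n}-\binom{n+j-1}{n}-r\right)\right).$$ Let $k:=\sum_{j=1}^m k_j$. Then $$F\in I(B\times\mathbb{P}^n)^k\subset\mathbb{F}[a_0,\dots,a_n,x_0,\dots,x_n].$$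
   Context: Interpolation matrix. Fix coordinates $(p_{i0},\dots,p_{in})$ of each $P_i$. Let $w=w(a_0,\dots,a_n)$ be the row vector of all $\binom{d+n}{n}$ monomials of degree $d$ in $a_0,\dots,a_n$, in some fixed order. For a tuple $Q=(q_0,\dots,q_n)$, $w(Q)$ denotes $w$ with $q_i$ substituted for $a_i$. The interpolation matrix $M$ is the square matrix of size $\binom{d+n}{n}$ with entries in $\mathbb{F}[a_0,\dots,a_n,x_0,\dots,x_n]$ whose rows are, in order: the $\binom{m+n-1}{n}$ rows $\frac{\partial^{m-1}}{\partial a_0^{t_0}\cdots\partial a_n^{t_n}}w$ for all $(t_0,\dots,t_n)\in\mathbb{Z}_{\ge0}^{n+1}$ with $t_0+\cdots+t_n=m-1$ (derivatives taken entrywise, in some fixed order); then the $r$ rows $w(P_1),\dots,w(P_r)$; and finally the row $w(x_0,\dots,x_n)$. $I(B\times\mathbb{P}^n)$ is the ideal of $\mathbb{F}[a_0,\dots,a_n,x_0,\dots,x_n]$ generated by the $2\times 2$ minors $b_ia_l-b_la_i$ of the matrix $\begin{bmatrix} b_0&b_1&\cdots&b_n\\ a_0&a_1&\cdots&a_n\end{bmatrix}$; its $k$-th power is the ordinary power of ideals (the $0$-th power being the whole ring). When $B\notin Z$, $k_j$ is the superabundance of $L_j$, i.e. its actual dimension minus its expected dimension. *)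

theory Defs
  imports "HOL-Library.Cardinality" "HOL-Library.Poly_Mapping" "Jordan_Normal_Form.Determinant"
begin

(* A monomial is its exponent vector; the polynomial ring over 'a in the variables 'v is the
   monoid algebra of the monomials. The library instances make it a commutative ring. *)
type_synonym 'v monomial = "'v \<Rightarrow>\<^sub>0 nat"
type_synonym ('v, 'a) mpoly = "'v monomial \<Rightarrow>\<^sub>0 'a"

definition Const :: "'a::zero \<Rightarrow> ('v, 'a) mpoly" where
  "Const c = Poly_Mapping.single 0 c"

definition Var :: "'v \<Rightarrow> ('v, 'a::zero_neq_one) mpoly" where
  "Var v = Poly_Mapping.single (Poly_Mapping.single v 1) 1"

definition mdegree :: "'v monomial \<Rightarrow> nat" where
  "mdegree t = (\<Sum>v\<in>Poly_Mapping.keys t. Poly_Mapping.lookup t v)"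

definition homogeneous :: "nat \<Rightarrow> ('v, 'a::zero) mpoly \<Rightarrow> bool" where
  "homogeneous d f \<longleftrightarrow> (\<forall>t\<in>Poly_Mapping.keys f. mdegree t = d)"

definition mono_at :: "('v \<Rightarrow> 'r::comm_semiring_1) \<Rightarrow> 'v monomial \<Rightarrow> 'r" where
  "mono_at q t = (\<Prod>v\<in>Poly_Mapping.keys t. q v ^ Poly_Mapping.lookup t v)"

definition evaluate :: "('v, 'a::comm_semiring_1) mpoly \<Rightarrow> ('v \<Rightarrow> 'a) \<Rightarrow> 'a" where
  "evaluate f q = (\<Sum>t\<in>Poly_Mapping.keys f. Poly_Mapping.lookup f t * mono_at q t)"


interpretation mpoly: vector_space "\<lambda>(c::'a::field) (p::('v, 'a) mpoly). Const c * p"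
  by standard (simp_all add: Const_def single_add algebra_simps mult_single flip: mult.assoc)

interpretation ring_module: Modules.module "(*) :: 'r::comm_ring_1 \<Rightarrow> 'r \<Rightarrow> 'r"
  by standard (simp_all add: algebra_simps)

definition ideal_gen :: "'r::comm_ring_1 set \<Rightarrow> 'r set" where
  "ideal_gen S = ring_module.span S"

primrec ideal_power :: "'r::comm_ring_1 set \<Rightarrow> nat \<Rightarrow> 'r set" where
  "ideal_power I 0 = UNIV"
| "ideal_power I (Suc k) = ideal_gen {f * g | f g. f \<in> I \<and> g \<in> ideal_power I k}"


definition pderivative :: "'v \<Rightarrow> ('v, 'a::comm_semiring_1) mpoly \<Rightarrow> ('v, 'a) mpoly" where
  "pderivative v p = (\<Sum>t\<in>Poly_Mapping.keys p.
     Poly_Mapping.single (t - Poly_Mapping.single v 1)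
       (of_nat (Poly_Mapping.lookup t v) * Poly_Mapping.lookup p t))"

(* For exponents s this is the derivative taken s v times in each variable v. The fold is
   well defined since partial derivatives commute (lemma comp_fun_commute_pderivative). *)
definition pderivatives :: "'v monomial \<Rightarrow> ('v, 'a::comm_semiring_1) mpoly \<Rightarrow> ('v, 'a) mpoly" where
  "pderivatives s p =
     Finite_Set.fold (\<lambda>v. pderivative v ^^ Poly_Mapping.lookup s v) p (Poly_Mapping.keys s)"

lemma lookup_pderivative:
  "Poly_Mapping.lookup (pderivative v p) t =
   of_nat (Suc (Poly_Mapping.lookup t v)) * Poly_Mapping.lookup p (t + Poly_Mapping.single v 1)"
proof -
  let ?e = "Poly_Mapping.single v (1::nat)"
  let ?f = "\<lambda>u. of_nat (Poly_Mapping.lookup u v) * Poly_Mapping.lookup p u"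
  have eq: "Poly_Mapping.lookup (Poly_Mapping.single (u - ?e) (?f u)) t
      = (if u = t + ?e then ?f u else 0)" for u
  proof (cases "Poly_Mapping.lookup u v = 0")
    case True
    then have "u \<noteq> t + ?e" by (auto simp: lookup_add)
    then show ?thesis using True by simp
  next
    case False
    have "u - ?e + ?e = u"
      by (rule poly_mapping_eqI)
        (use False in \<open>auto simp: lookup_add lookup_minus lookup_single when_def\<close>)
    then have "u - ?e = t \<longleftrightarrow> u = t + ?e" by auto
    then show ?thesis by (simp add: lookup_single when_def)
  qed
  have "Poly_Mapping.lookup (pderivative v p) t
      = (\<Sum>u\<in>Poly_Mapping.keys p. if u = t + ?e then ?f u else 0)"
    unfolding pderivative_def lookup_sum eq ..
  also have "\<dots> = ?f (t + ?e)"
    by (simp add: in_keys_iff)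
  finally show ?thesis by (simp add: lookup_add)
qed

lemma pderivative_commute:
  "pderivative u (pderivative v p) = pderivative v (pderivative u p)"
  by (rule poly_mapping_eqI)
    (auto simp: lookup_pderivative lookup_add lookup_single when_def ac_simps)

lemma comp_fun_commute_pderivative:
  "comp_fun_commute (\<lambda>v. pderivative v ^^ (c v))"
proof
  fix u v
  have 1: "(pderivative u ^^ i) (pderivative v p) = pderivative v ((pderivative u ^^ i) p)"
    for i and p :: "('a, 'b) mpoly"
    by (induction i) (simp_all add: pderivative_commute[of u v])
  have "(pderivative u ^^ i) ((pderivative v ^^ j) p) = (pderivative v ^^ j) ((pderivative u ^^ i) p)"
    for i j and p :: "('a, 'b) mpoly"
    by (induction j) (simp_all add: 1)
  then show "(pderivative v ^^ c v) \<circ> (pderivative u ^^ c u)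
      = ((pderivative u ^^ c u) \<circ> (pderivative v ^^ c v) :: ('a, 'b) mpoly \<Rightarrow> _)"
    by (auto simp: fun_eq_iff)
qed


(* Points of projective space are given by nonzero coordinate vectors; the coordinates are
   indexed by a finite type with n + 1 elements. *)
definition proj_point :: "('n \<Rightarrow> 'a::field) \<Rightarrow> bool" where
  "proj_point p \<longleftrightarrow> (\<exists>i. p i \<noteq> 0)"

definition proj_eq :: "('n \<Rightarrow> 'a::field) \<Rightarrow> ('n \<Rightarrow> 'a) \<Rightarrow> bool" where
  "proj_eq p q \<longleftrightarrow> (\<exists>c. c \<noteq> 0 \<and> (\<forall>i. q i = c * p i))"

definition vanishing_ideal :: "('n \<Rightarrow> 'a::field) set \<Rightarrow> ('n, 'a) mpoly set" where
  "vanishing_ideal Z = ideal_gen {f. (\<exists>e. homogeneous e f) \<and> (\<forall>p\<in>Z. evaluate f p = 0)}"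

(* Vanishing at B with multiplicity at least j is membership in I(jB), the j-th power of I(B). *)
definition fat_forms ::
  "nat \<Rightarrow> ('n \<Rightarrow> 'a::field) set \<Rightarrow> ('n \<Rightarrow> 'a) \<Rightarrow> nat \<Rightarrow> ('n, 'a) mpoly set" where
  "fat_forms d Z B j =
     {f \<in> ideal_power (vanishing_ideal {B}) j \<inter> vanishing_ideal Z. homogeneous d f}"


(* In F[a, x] the variables a_i and x_i are Inl i and Inr i. *)
definition a_var :: "'n \<Rightarrow> ('n + 'n, 'a::field) mpoly" where
  "a_var i = Var (Inl i)"

definition x_var :: "'n \<Rightarrow> ('n + 'n, 'a::field) mpoly" where
  "x_var i = Var (Inr i)"

(* ws and ts list the monomials of degree d and the derivative exponents of degree m - 1 in
   the chosen orders; ps lists the coordinates of the points. *)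
definition interpolation_matrix ::
  "'n monomial list \<Rightarrow> 'n monomial list \<Rightarrow> ('n \<Rightarrow> 'a::field) list \<Rightarrow> ('n + 'n, 'a) mpoly mat" where
  "interpolation_matrix ws ts ps = (
     let w = (\<lambda>q. map (mono_at q) ws);
         a_exponents = (\<lambda>t. \<Sum>i\<in>Poly_Mapping.keys t.
           Poly_Mapping.single (Inl i) (Poly_Mapping.lookup t i))
     in mat_of_rows_list (length ws)
          (map (\<lambda>t. map (pderivatives (a_exponents t)) (w a_var)) ts
           @ map (\<lambda>p. w (\<lambda>i. Const (p i))) ps
           @ [w x_var]))"

definition point_times_space_ideal :: "('n \<Rightarrow> 'a::field) \<Rightarrow> ('n + 'n, 'a) mpoly set" where
  "point_times_space_ideal b =
     ideal_gen {Const (b i) * a_var l - Const (b l) * a_var i | i l. True}"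

end

theory Submission
  imports Defs
begin

text \<open>
  Let \<open>J\<close> be the ideal of \<open>B \<times> P\<^sup>n\<close> and \<open>b\<^sub>0 \<noteq> 0\<close> a coordinate of \<open>B\<close>. A derivation maps \<open>J\<^sup>j\<close> to
  \<open>J\<^sup>j\<^sup>-\<^sup>1\<close>, and the derivation \<open>\<Sum> b\<^sub>i \<partial>/\<partial>a\<^sub>i\<close> in the direction \<open>B\<close> even preserves \<open>J\<^sup>j\<close>, since it kills
  the minors \<open>b\<^sub>i a\<^sub>l - b\<^sub>l a\<^sub>i\<close>. So replace \<open>\<partial>/\<partial>a\<^sub>0\<close> by it: up to a constant matrix factor, the
  derivative rows become rows \<open>D\<^sup>u\<close> that map a form vanishing to order \<open>j\<close> at \<open>B\<close> into
  \<open>J\<close> to the power \<open>j - |u'|\<close>, where \<open>u'\<close> is \<open>u\<close> without its entry at \<open>0\<close>. Likewise, up to a constant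
  factor, the columns may be indexed by a basis of the forms of degree \<open>d\<close> adapted to
  \<open>L\<^sub>1 \<supseteq> \<dots> \<supseteq> L\<^sub>m\<close>. In a nonzero term of the expanded determinant, no column of \<open>L\<^sub>j\<close> meets a point row and at
  most one meets the last row, while only \<open>(m+n-1 choose n) - (j+n-1 choose n)\<close> derivative
  rows have \<open>|u'| \<ge> j\<close>. Hence at least \<open>k\<^sub>j\<close> columns of \<open>L\<^sub>j\<close> meet derivative rows with \<open>|u'| < j\<close>,
  and summing over \<open>j\<close> bounds the total order of the term from below by \<open>k\<close>.
\<close>

section \<open>Powers of ideals and derivations\<close>

lemma ideal_gen_ideal: "ring_module.subspace (ideal_gen S)"
  by (simp add: ideal_gen_def)

lemma ideal_power_ideal: "ring_module.subspace (ideal_power I k)"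
  by (cases k) (auto simp: ideal_gen_ideal)

lemma ideal_power_Suc_mult:
  "f \<in> I \<Longrightarrow> g \<in> ideal_power I k \<Longrightarrow> f * g \<in> ideal_power I (Suc k)"
  by (auto simp: ideal_gen_def intro!: ring_module.span_base)

lemma ideal_power_Suc_subset: "ideal_power I (Suc k) \<subseteq> ideal_power I k"
  unfolding ideal_power.simps ideal_gen_def
  by (rule ring_module.span_minimal)
    (auto intro: ring_module.subspace_scale[OF ideal_power_ideal] ideal_power_ideal)

lemma ideal_power_antimono: "i \<le> j \<Longrightarrow> ideal_power I j \<subseteq> ideal_power I i"
  by (rule lift_Suc_antimono_le[of "ideal_power I"]) (rule ideal_power_Suc_subset)

lemma ideal_power_add_mult:
  assumes "f \<in> ideal_power I i" and g: "g \<in> ideal_power I j"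
  shows "f * g \<in> ideal_power I (i + j)"
  using assms(1)
proof (induction i arbitrary: f)
  case 0
  show ?case using ring_module.subspace_scale[OF ideal_power_ideal g, of f] by simp
next
  case (Suc i)
  note ideal = ideal_power_ideal[of I "Suc (i + j)"]
  have "f \<in> ring_module.span {f * g | f g. f \<in> I \<and> g \<in> ideal_power I i}"
    using Suc.prems by (simp add: ideal_gen_def)
  then have "f * g \<in> ideal_power I (Suc (i + j))"
  proof (induction rule: ring_module.span_induct_alt)
    case base
    show ?case using ring_module.subspace_0[OF ideal] by (simp only: mult_zero_left)
  next
    case (step c x y)
    obtain a b where x: "x = a * b" "a \<in> I" "b \<in> ideal_power I i" using step(1) by auto
    have "c * (a * (b * g)) + y * g \<in> ideal_power I (Suc (i + j))"
      by (intro ring_module.subspace_add[OF ideal] ring_module.subspace_scale[OF ideal]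
          ideal_power_Suc_mult x step Suc.IH)
    then show ?case by (simp only: x algebra_simps)
  qed
  then show ?case by simp
qed

lemma prod_in_ideal_power:
  "(\<And>i. i \<in> A \<Longrightarrow> f i \<in> ideal_power I (e i)) \<Longrightarrow> prod f A \<in> ideal_power I (sum e A)"
  by (induction A rule: infinite_finite_induct) (auto intro: ideal_power_add_mult)

lemma det_in_ideal_power:
  assumes "M \<in> carrier_mat N N"
    and "\<And>p. p permutes {0..<N} \<Longrightarrow> (\<Prod>i=0..<N. M $$ (i, p i)) \<in> ideal_power I k"
  shows "det M \<in> ideal_power I k"
  unfolding det_def'[OF assms(1)]
  using assms(2) by (intro ring_module.subspace_sum[OF ideal_power_ideal]
      ring_module.subspace_scale[OF ideal_power_ideal]) auto

lemma prod_cong_mod_ideal: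
  assumes I: "ring_module.subspace I"
    and "\<And>i. i \<in> A \<Longrightarrow> f i - g i \<in> I"
  shows "prod f A - prod g A \<in> I"
  using assms(2)
proof (induction A rule: infinite_finite_induct)
  case (insert i A)
  have "prod f A * (f i - g i) + g i * (prod f A - prod g A) \<in> I"
    using insert by (intro ring_module.subspace_add[OF I] ring_module.subspace_scale[OF I]) auto
  then show ?case using insert by (simp add: algebra_simps)
qed (simp_all add: ring_module.subspace_0[OF I])

lemma power_cong_mod_ideal:
  assumes "ring_module.subspace I" and "x - y \<in> I"
  shows "x ^ k - y ^ k \<in> I"
  using prod_cong_mod_ideal[OF assms(1), of "{..<k}" "\<lambda>_. x" "\<lambda>_. y"] assms(2) by simp

section \<open>Derivations and powers of ideals\<close>

definition derivation :: "('r::comm_ring_1 \<Rightarrow> 'r) \<Rightarrow> bool" where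
  "derivation D \<longleftrightarrow> (\<forall>x y. D (x + y) = D x + D y) \<and> (\<forall>x y. D (x * y) = D x * y + x * D y)"

lemma
  assumes "derivation D"
  shows derivation_add: "D (x + y) = D x + D y"
    and derivation_mult: "D (x * y) = D x * y + x * D y"
    and derivation_0: "D 0 = 0"
proof -
  show *: "D (x + y) = D x + D y" for x y using assms unfolding derivation_def by blast
  show "D (x * y) = D x * y + x * D y" using assms unfolding derivation_def by blast
  show "D 0 = 0" using *[of 0 0] by simp
qed

text \<open>In \<open>D (c * x) = D c * x + c * D x\<close> the first summand is a multiple of the
  generator \<open>x\<close>, so stability has to be checked on generators only.\<close>

lemma derivation_ideal_gen:
  assumes D: "derivation D" and "\<And>s. s \<in> S \<Longrightarrow> D s \<in> ideal_gen S"
    and "x \<in> ideal_gen S"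
  shows "D x \<in> ideal_gen S"
  using assms(3) unfolding ideal_gen_def
proof (induction rule: ring_module.span_induct_alt)
  case base
  then show ?case by (simp add: derivation_0[OF D] ring_module.span_zero)
next
  case (step c x y)
  have "D c * x + c * D x + D y \<in> ring_module.span S"
    using step(2) assms(2)[OF step(1)] ring_module.span_base[OF step(1)]
    unfolding ideal_gen_def by (intro ring_module.span_add ring_module.span_scale)
  then show ?case by (simp add: derivation_add[OF D] derivation_mult[OF D])
qed

text \<open>By the Leibniz rule on \<open>f * g\<close>, the summand with \<open>D f\<close> still
  contains \<open>g\<close> from the \<open>k\<close>-th power, and the summand with
  \<open>D g\<close> loses one power by induction but keeps the factor \<open>f\<close>. For
  \<open>k = 0\<close> the truncated exponent denotes the whole ring.\<close>

lemma derivation_ideal_power: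
  assumes D: "derivation D" and "x \<in> ideal_power I k"
  shows "D x \<in> ideal_power I (k - 1)"
  using assms(2)
proof (induction k arbitrary: x)
  case (Suc k)
  note ideal = ideal_power_ideal[of I k]
  have "x \<in> ring_module.span {f * g | f g. f \<in> I \<and> g \<in> ideal_power I k}"
    using Suc.prems by (simp add: ideal_gen_def)
  then have "D x \<in> ideal_power I k"
  proof (induction rule: ring_module.span_induct_alt)
    case base
    then show ?case by (simp add: derivation_0[OF D] ring_module.subspace_0[OF ideal])
  next
    case (step c x y)
    obtain f g where x: "x = f * g" "f \<in> I" and g: "g \<in> ideal_power I k" using step(1) by auto
    have fDg: "f * D g \<in> ideal_power I k"
    proof (cases k)
      case (Suc k')
      then show ?thesis using Suc.IH[OF g] ideal_power_Suc_mult[OF x(2), of "D g" k'] by simp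
    qed simp
    then have "(D c * f + c * D f) * g + c * (f * D g) + D y \<in> ideal_power I k"
      by (intro ring_module.subspace_add[OF ideal] step(2)
          ring_module.subspace_scale[OF ideal g] ring_module.subspace_scale[OF ideal fDg])
    moreover have "D (c * x + y) = (D c * f + c * D f) * g + c * (f * D g) + D y"
      unfolding derivation_add[OF D] derivation_mult[OF D] x(1) by (simp only: algebra_simps)
    ultimately show ?case by (simp only:)
  qed
  then show ?case by simp
qed simp

text \<open>If \<open>D\<close> maps the ideal into itself, both Leibniz summands of
  \<open>D (f * g)\<close> keep all their factors in the ideal. This is what makes differentiation
  in the direction \<open>B\<close> free of cost.\<close>

lemma derivation_ideal_power_stable:
  assumes D: "derivation D" and stable: "\<And>s. s \<in> S \<Longrightarrow> D s \<in> ideal_gen S"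
    and "x \<in> ideal_power (ideal_gen S) k"
  shows "D x \<in> ideal_power (ideal_gen S) k"
  using assms(3)
proof (induction k arbitrary: x)
  case (Suc k)
  let ?I = "ideal_gen S"
  have "D x \<in> ideal_power ?I (Suc k)"
    unfolding ideal_power.simps
  proof (rule derivation_ideal_gen[OF D _ Suc.prems[unfolded ideal_power.simps]])
    fix s assume "s \<in> {f * g |f g. f \<in> ?I \<and> g \<in> ideal_power ?I k}"
    then obtain f g where s: "s = f * g" "f \<in> ?I" "g \<in> ideal_power ?I k" by auto
    have "D f * g + f * D g \<in> ideal_power ?I (Suc k)"
      by (intro ring_module.subspace_add[OF ideal_power_ideal] ideal_power_Suc_mult
          derivation_ideal_gen[OF D stable] s Suc.IH)
    then show "D s \<in> ideal_gen {f * g |f g. f \<in> ?I \<and> g \<in> ideal_power ?I k}"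
      by (simp add: s derivation_mult[OF D])
  qed
  then show ?case .
qed simp

text \<open>Serves to turn vanishing of order \<open>j\<close> at \<open>B\<close> into membership
  in the \<open>j\<close>-th power of the ideal of \<open>B\<close> times projective space, with
  \<open>subst a_var\<close> as \<open>h\<close>.\<close>

lemma ideal_power_hom:
  assumes add: "\<And>x y. h (x + y) = h x + h y" and mult: "\<And>x y. h (x * y) = h x * h y"
    and I: "\<And>x. x \<in> I \<Longrightarrow> h x \<in> J"
    and "x \<in> ideal_power I k"
  shows "h x \<in> ideal_power J k"
  using assms(4)
proof (induction k arbitrary: x)
  case (Suc k)
  have "x \<in> ring_module.span {f * g | f g. f \<in> I \<and> g \<in> ideal_power I k}"
    using Suc.prems by (simp add: ideal_gen_def)
  then show ?case
  proof (induction rule: ring_module.span_induct_alt)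
    case base
    have "h 0 = 0" using add[of 0 0] by simp
    then show ?case by (simp add: ring_module.subspace_0[OF ideal_gen_ideal])
  next
    case (step c x y)
    then obtain f g where x: "x = f * g" "f \<in> I" "g \<in> ideal_power I k" by auto
    have "h c * (h f * h g) + h y \<in> ideal_power J (Suc k)"
      by (intro ring_module.subspace_add[OF ideal_power_ideal] step(2)
          ring_module.subspace_scale[OF ideal_power_ideal] ideal_power_Suc_mult I Suc.IH x)
    then show ?case by (simp only: add mult x)
  qed
qed simp


section \<open>Monomials, substitution and partial derivatives\<close>

lemma monomial_diff_add_single:
  fixes t :: "'v monomial"
  assumes "Poly_Mapping.lookup t v \<noteq> 0"
  shows "t - Poly_Mapping.single v 1 + Poly_Mapping.single v 1 = t"
  by (rule poly_mapping_eqI)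
    (use assms in \<open>auto simp: lookup_add lookup_minus lookup_single when_def\<close>)

lemma mdegree_eq_sum:
  "finite A \<Longrightarrow> Poly_Mapping.keys t \<subseteq> A \<Longrightarrow> mdegree t = (\<Sum>v\<in>A. Poly_Mapping.lookup t v)"
  unfolding mdegree_def by (rule sum.mono_neutral_left) (auto simp: in_keys_iff)

lemma mdegree_eq_sum_UNIV: "mdegree t = (\<Sum>v\<in>UNIV. Poly_Mapping.lookup t v)"
  for t :: "'n::finite monomial"
  by (rule mdegree_eq_sum) auto

lemma mdegree_add: "mdegree (s + t) = mdegree s + mdegree t"
  by (simp add: mdegree_eq_sum[of "Poly_Mapping.keys s \<union> Poly_Mapping.keys t"]
      Poly_Mapping.keys_add lookup_add sum.distrib)

lemma mdegree_single [simp]: "mdegree (Poly_Mapping.single v e) = e"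
  by (simp add: mdegree_def)

lemma mdegree_eq_0_iff: "mdegree t = 0 \<longleftrightarrow> t = 0"
  by (auto simp: mdegree_def in_keys_iff intro!: poly_mapping_eqI)

lemma monomial_induct [case_names zero add]:
  fixes t :: "'v monomial"
  assumes "P 0" and "\<And>t v. P t \<Longrightarrow> P (t + Poly_Mapping.single v 1)"
  shows "P t"
proof (induction "mdegree t" arbitrary: t)
  case 0
  then show ?case using assms(1) by (simp add: mdegree_eq_0_iff)
next
  case (Suc e)
  then have "t \<noteq> 0" using mdegree_eq_0_iff[of t] by auto
  then obtain v where v: "Poly_Mapping.lookup t v \<noteq> 0"
    by (metis lookup_zero poly_mapping_eqI)
  note t = monomial_diff_add_single[OF v]
  have "mdegree (t - Poly_Mapping.single v 1) = e"
    using arg_cong[OF t, of mdegree] Suc.hyps(2) by (simp add: mdegree_add)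
  then show ?case using assms(2)[OF Suc.hyps(1), of "t - Poly_Mapping.single v 1" v] t by simp
qed

text \<open>Stars and bars: exponent vectors of degree \<open>e\<close> are the multiplicity
  functions of multisets of size \<open>e\<close> on the \<open>n + 1\<close> variables.\<close>

lemma card_monomials:
  assumes "CARD('n::finite) = n + 1"
  shows "card {t :: 'n monomial. mdegree t = e} = (n + e) choose n"
proof -
  have size: "size M = (\<Sum>v\<in>UNIV. count M v)" for M :: "'n multiset"
    unfolding size_multiset_overloaded_eq
    by (rule sum.mono_neutral_left) (auto simp: not_in_iff)
  have "bij_betw (\<lambda>M. Abs_poly_mapping (count M)) (multisets_of_size (UNIV :: 'n set) e)
      {t. mdegree t = e}"
    by (rule bij_betw_byWitness[where f' = "\<lambda>t. Abs_multiset (Poly_Mapping.lookup t)"])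
      (auto simp: multisets_of_size_def mdegree_eq_sum_UNIV size count_Abs_multiset
        poly_mapping_eq_iff intro!: multiset_eqI)
  then have "card {t :: 'n monomial. mdegree t = e} = card (multisets_of_size (UNIV :: 'n set) e)"
    by (rule bij_betw_same_card[symmetric])
  also have "\<dots> = (n + e) choose e" using assms by (simp add: card_multisets_of_size)
  finally show ?thesis using binomial_symmetric[of n "n + e"] by simp
qed

lemma mono_at_eq_prod:
  "finite A \<Longrightarrow> Poly_Mapping.keys t \<subseteq> A \<Longrightarrow> mono_at q t = (\<Prod>v\<in>A. q v ^ Poly_Mapping.lookup t v)"
  unfolding mono_at_def by (rule prod.mono_neutral_left) (auto simp: in_keys_iff)

lemma mono_at_0 [simp]: "mono_at q 0 = 1"
  by (simp add: mono_at_def)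

lemma mono_at_add: "mono_at q (s + t) = mono_at q s * mono_at q t"
  by (simp add: mono_at_eq_prod[of "Poly_Mapping.keys s \<union> Poly_Mapping.keys t"]
      Poly_Mapping.keys_add lookup_add prod.distrib power_add)

lemma mono_at_scale: "mono_at (\<lambda>v. c * q v) t = c ^ mdegree t * mono_at q t"
  by (simp add: mono_at_def mdegree_def power_mult_distrib prod.distrib power_sum)

lemma mpoly_eq_sum_single:
  fixes p :: "('v, 'a::comm_monoid_add) mpoly"
  shows "p = (\<Sum>t\<in>Poly_Mapping.keys p. Poly_Mapping.single t (Poly_Mapping.lookup p t))"
  by (rule poly_mapping_eqI)
    (auto simp: lookup_sum lookup_single when_def in_keys_iff sum.delta)

lemma mpoly_induct [case_names single add]:
  fixes p :: "('v, 'a::comm_monoid_add) mpoly"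
  assumes single: "\<And>t c. P (Poly_Mapping.single t c)"
    and add: "\<And>p q. P p \<Longrightarrow> P q \<Longrightarrow> P (p + q)"
  shows "P p"
proof -
  have "P (\<Sum>t\<in>A. Poly_Mapping.single t (Poly_Mapping.lookup p t))" if "finite A" for A
    \<comment> \<open>The empty sum is covered by \<open>single\<close> with coefficient 0.\<close>
    using that by (induction A) (use single[of _ 0] in \<open>auto intro: assms\<close>)
  from this[of "Poly_Mapping.keys p"] show ?thesis using mpoly_eq_sum_single[of p] by simp
qed

lemma Const_0 [simp]: "Const 0 = 0"
  by (simp add: Const_def)

lemma Const_1 [simp]: "Const 1 = 1"
  by (simp add: Const_def)

lemma Const_add: "Const (a + b) = Const a + Const b"
  by (simp add: Const_def single_add)

lemma Const_mult: "Const (a * b) = Const a * Const b"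
  by (simp add: Const_def mult_single)

lemma Const_power: "Const (a ^ k) = Const a ^ k"
  by (induction k) (simp_all add: Const_mult)

lemma Const_sum: "Const (sum f A) = (\<Sum>i\<in>A. Const (f i))"
  by (induction A rule: infinite_finite_induct) (simp_all add: Const_add)

lemma Const_prod: "Const (prod f A) = (\<Prod>i\<in>A. Const (f i))"
  by (induction A rule: infinite_finite_induct) (simp_all add: Const_mult)

lemma single_eq_Const_mult: "Poly_Mapping.single t c = Const c * Poly_Mapping.single t 1"
  for c :: "'a::comm_semiring_1"
  by (simp add: Const_def mult_single)

lemma mono_at_Const: "mono_at (\<lambda>v. Const (q v)) t = Const (mono_at q t)"
  by (simp add: mono_at_def Const_prod Const_power)

text \<open>Substitution of polynomials for the variables. It covers the renamings to
  \<open>a_var\<close> and \<open>x_var\<close> as well as evaluation at a constant point, so that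
  every row of the interpolation matrix becomes an operator on forms.\<close>

definition subst ::
  "('n \<Rightarrow> ('v, 'a) mpoly) \<Rightarrow> ('n, 'a::comm_ring_1) mpoly \<Rightarrow> ('v, 'a) mpoly" where
  "subst q f = (\<Sum>t\<in>Poly_Mapping.keys f. Const (Poly_Mapping.lookup f t) * mono_at q t)"

lemma subst_single: "subst q (Poly_Mapping.single t c) = Const c * mono_at q t"
  by (simp add: subst_def)

lemma subst_0 [simp]: "subst q 0 = 0"
  by (simp add: subst_def)

lemma subst_add: "subst q (f + g) = subst q f + subst q g"
  unfolding subst_def
  by (rule setsum_keys_plus_distrib) (simp_all add: Const_add distrib_right)

lemma subst_mult: "subst q (f * g) = subst q f * subst q g"
proof (induction f rule: mpoly_induct)
  case (single t c)
  show ?case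
    by (induction g rule: mpoly_induct)
      (simp_all only: mult_single subst_single subst_add Const_mult mono_at_add distrib_left distrib_right ac_simps)
qed (simp only: subst_add distrib_right)

lemma subst_Const: "subst q (Const c) = Const c"
  by (simp add: Const_def[of c] subst_single)

lemma subst_Const_point: "subst (\<lambda>v. Const (q v)) f = Const (evaluate f q)"
  by (simp add: subst_def evaluate_def Const_sum Const_mult mono_at_Const)

section \<open>Partial derivatives as derivations\<close>

lemma pderivative_add: "pderivative v (p + q) = pderivative v p + pderivative v q"
  by (rule poly_mapping_eqI) (simp add: lookup_pderivative lookup_add algebra_simps)

lemma pderivative_single:
  "pderivative v (Poly_Mapping.single t c) =
   Poly_Mapping.single (t - Poly_Mapping.single v 1) (of_nat (Poly_Mapping.lookup t v) * c)"
  by (simp add: pderivative_def)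

lemma pderivative_Const: "pderivative v (Const c) = 0"
  by (simp add: Const_def pderivative_single)

lemma pderivative_Var: "pderivative v (Var u) = (if u = v then 1 else 0)"
  by (simp add: Var_def pderivative_single lookup_single when_def)

lemma pderivative_mult_single:
  fixes a b :: "'a::comm_semiring_1"
  shows
  "pderivative v (Poly_Mapping.single s a * Poly_Mapping.single t b) =
   pderivative v (Poly_Mapping.single s a) * Poly_Mapping.single t b +
   Poly_Mapping.single s a * pderivative v (Poly_Mapping.single t b)"
proof -
  let ?e = "Poly_Mapping.single v (1::nat)"
  have s: "s + t - ?e = s - ?e + t" if "Poly_Mapping.lookup s v \<noteq> 0" for s t
  proof -
    have "s + t = (s - ?e + t) + ?e"
      using monomial_diff_add_single[OF that] by (metis add.assoc add.commute)
    then show ?thesis by (metis add_diff_cancel_right')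
  qed
  \<comment> \<open>If \<open>v\<close> does not occur in \<open>s\<close>, truncated subtraction
    can make the two exponents differ, but then both coefficients are 0.\<close>
  have eq1: "Poly_Mapping.single (s + t - ?e) (of_nat (Poly_Mapping.lookup s v) * c) =
      Poly_Mapping.single (s - ?e + t) (of_nat (Poly_Mapping.lookup s v) * c)" for s t and c :: 'a
    using s[of s t] by (cases "Poly_Mapping.lookup s v = 0") simp_all
  have "of_nat (Poly_Mapping.lookup (s + t) v) * (a * b) =
      of_nat (Poly_Mapping.lookup s v) * (a * b) + of_nat (Poly_Mapping.lookup t v) * (a * b)"
    by (simp add: lookup_add algebra_simps)
  then show ?thesis
    using eq1[of s t "a * b"] eq1[of t s "a * b"]
    by (simp only: mult_single pderivative_single single_add ac_simps)
qed

lemma derivation_pderivative: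
  "derivation (pderivative v :: ('v, 'a::comm_ring_1) mpoly \<Rightarrow> ('v, 'a) mpoly)"
proof -
  have "pderivative v (p * q) = pderivative v p * q + p * pderivative v q"
    for p q :: "('v, 'a) mpoly"
  proof (induction p rule: mpoly_induct)
    case (single t c)
    show ?case
      by (induction q rule: mpoly_induct)
        (simp_all only: pderivative_mult_single pderivative_add distrib_left distrib_right ac_simps)
  qed (simp only: pderivative_add distrib_left distrib_right ac_simps)
  then show ?thesis by (simp add: derivation_def pderivative_add)
qed


section \<open>Iterated commuting operators\<close>

text \<open>Linearity over the field of constants; derivations are not linear over the polynomial
  ring.\<close>

definition mpoly_linear :: "(('v, 'a::comm_ring_1) mpoly \<Rightarrow> ('w, 'a) mpoly) \<Rightarrow> bool" where
  "mpoly_linear D \<longleftrightarrow>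
     (\<forall>p q. D (p + q) = D p + D q) \<and> (\<forall>c p. D (Const c * p) = Const c * D p)"

lemma
  assumes "mpoly_linear D"
  shows mpoly_linear_add: "D (p + q) = D p + D q"
    and mpoly_linear_scale: "D (Const c * p) = Const c * D p"
    and mpoly_linear_0: "D 0 = 0"
proof -
  show *: "D (p + q) = D p + D q" for p q using assms unfolding mpoly_linear_def by blast
  show "D (Const c * p) = Const c * D p" using assms unfolding mpoly_linear_def by blast
  show "D 0 = 0" using *[of 0 0] by simp
qed

lemma mpoly_linear_sum:
  assumes "mpoly_linear D"
  shows "D (\<Sum>i\<in>A. Const (c i) * f i) = (\<Sum>i\<in>A. Const (c i) * D (f i))"
  by (induction A rule: infinite_finite_induct)
    (simp_all add: mpoly_linear_add[OF assms] mpoly_linear_scale[OF assms] mpoly_linear_0[OF assms])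

lemma mpoly_linear_comp: "mpoly_linear D \<Longrightarrow> mpoly_linear E \<Longrightarrow> mpoly_linear (\<lambda>p. D (E p))"
  by (simp add: mpoly_linear_def)

lemma mpoly_linear_subst: "mpoly_linear (subst q)"
  by (simp add: mpoly_linear_def subst_add subst_mult subst_Const)

lemma mpoly_linear_pderivative: "mpoly_linear (pderivative v)"
  by (simp add: mpoly_linear_def pderivative_add pderivative_Const
      derivation_mult[OF derivation_pderivative])


text \<open>The monomial \<open>t\<close> evaluated at a commuting family of operators. Unlike
  \<open>pderivatives\<close> it admits any family \<open>D\<close>, so that the coordinate
  derivations can be exchanged for others.\<close>

definition multi_op :: "('n::finite \<Rightarrow> 'r \<Rightarrow> 'r) \<Rightarrow> 'n monomial \<Rightarrow> 'r \<Rightarrow> 'r" where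
  "multi_op D t p = Finite_Set.fold (\<lambda>v. D v ^^ Poly_Mapping.lookup t v) p UNIV"

lemma comp_fun_commute_powers:
  assumes "\<And>u v p. D u (D v p) = D v (D u p)"
  shows "comp_fun_commute (\<lambda>v. D v ^^ (c v :: nat))"
proof -
  interpret comp_fun_commute D by standard (auto simp: assms)
  show ?thesis by (rule comp_fun_commute_funpow)
qed

lemma multi_op_0 [simp]: "multi_op D 0 p = p"
  for D :: "'n::finite \<Rightarrow> 'r \<Rightarrow> 'r"
proof -
  interpret comp_fun_commute "\<lambda>_ p. p" by standard auto
  have "Finite_Set.fold (\<lambda>_ p. p) p A = p" if "finite A" for A :: "'n set"
    using that by induction auto
  then show ?thesis by (simp add: multi_op_def id_def)
qed

text \<open>Commutativity allows the factor at \<open>v\<close> to be split off the fold; the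
  remaining factors do not see the change of exponent.\<close>

lemma multi_op_add_single:
  assumes "\<And>u v p. D u (D v p) = D v (D u p)"
  shows "multi_op D (t + Poly_Mapping.single v 1) p = D v (multi_op D t p)"
proof -
  let ?t = "t + Poly_Mapping.single v (1::nat)"
  note commute = comp_fun_commute_powers[of D, OF assms]
  have fold: "Finite_Set.fold (\<lambda>u. D u ^^ c u) p UNIV =
      (D v ^^ c v) (Finite_Set.fold (\<lambda>u. D u ^^ c u) p (UNIV - {v}))" for c
    
  proof -
    interpret comp_fun_commute "\<lambda>u. D u ^^ c u" by (rule commute)
    show ?thesis by (rule fold_rec) auto
  qed
  have "Finite_Set.fold (\<lambda>u. D u ^^ Poly_Mapping.lookup ?t u) p (UNIV - {v}) =
      Finite_Set.fold (\<lambda>u. D u ^^ Poly_Mapping.lookup t u) p (UNIV - {v})"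
    by (rule Finite_Set.fold_cong)
      (use commute in \<open>auto simp: comp_fun_commute_def' lookup_add lookup_single\<close>)
  then show ?thesis
    by (simp add: multi_op_def fold lookup_add)
qed

lemma multi_op_mpoly_linear:
  assumes "\<And>u v p. D u (D v p) = D v (D u p)" and D: "\<And>v. mpoly_linear (D v)"
  shows "mpoly_linear (multi_op D t)"
proof (induction t rule: monomial_induct)
  case zero
  then show ?case by (simp add: mpoly_linear_def)
next
  case (add t v)
  show ?case
    unfolding multi_op_add_single[of D, OF assms(1), abs_def] by (rule mpoly_linear_comp[OF D add])
qed

text \<open>The homogeneous polynomials of degree \<open>e\<close> in the operators
  \<open>D v\<close>, with constant coefficients.\<close>

definition multi_op_span ::
  "('n::finite \<Rightarrow> ('v, 'a::comm_ring_1) mpoly \<Rightarrow> ('v, 'a) mpoly) \<Rightarrow> nat \<Rightarrow>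
   (('v, 'a) mpoly \<Rightarrow> ('v, 'a) mpoly) set" where
  "multi_op_span D e =
     {E. \<exists>c. \<forall>p. E p = (\<Sum>u\<in>{u. mdegree u = e}. Const (c u) * multi_op D u p)}"

lemma multi_op_span_add:
  assumes "E \<in> multi_op_span D e" and "E' \<in> multi_op_span D e"
  shows "(\<lambda>p. E p + E' p) \<in> multi_op_span D e"
proof -
  obtain c c' where "\<And>p. E p = (\<Sum>u\<in>{u. mdegree u = e}. Const (c u) * multi_op D u p)"
    "\<And>p. E' p = (\<Sum>u\<in>{u. mdegree u = e}. Const (c' u) * multi_op D u p)"
    using assms unfolding multi_op_span_def by blast
  then have "\<forall>p. E p + E' p =
      (\<Sum>u\<in>{u. mdegree u = e}. Const (c u + c' u) * multi_op D u p)"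
    by (simp add: Const_add distrib_right sum.distrib)
  then show ?thesis unfolding multi_op_span_def by (intro CollectI exI)
qed

lemma multi_op_span_scale:
  assumes "E \<in> multi_op_span D e"
  shows "(\<lambda>p. Const a * E p) \<in> multi_op_span D e"
proof -
  obtain c where "\<And>p. E p = (\<Sum>u\<in>{u. mdegree u = e}. Const (c u) * multi_op D u p)"
    using assms unfolding multi_op_span_def by blast
  then have "\<forall>p. Const a * E p =
      (\<Sum>u\<in>{u. mdegree u = e}. Const (a * c u) * multi_op D u p)"
    by (simp only: Const_mult sum_distrib_left mult.assoc simp_thms)
  then show ?thesis unfolding multi_op_span_def by (intro CollectI exI)
qed

lemma multi_op_span_sum:
  assumes "\<And>i. i \<in> A \<Longrightarrow> E i \<in> multi_op_span D e"
  shows "(\<lambda>p. \<Sum>i\<in>A. E i p) \<in> multi_op_span D e"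
  using assms
proof (induction A rule: infinite_finite_induct)
  case (insert i A)
  then show ?case by (simp add: multi_op_span_add)
qed (auto simp: multi_op_span_def intro!: exI[of _ "\<lambda>_. 0"])

lemma finite_monomials: "finite {t :: 'n::finite monomial. mdegree t = e}"
proof (rule card_ge_0_finite)
  have "CARD('n) = (CARD('n) - 1) + 1" by simp
  from card_monomials[OF this] show "card {t :: 'n monomial. mdegree t = e} > 0" by simp
qed

text \<open>Applying \<open>D v\<close> shifts the index from \<open>u\<close> to \<open>u\<close>
  plus the unit exponent at \<open>v\<close>; the coefficients move along.\<close>

lemma multi_op_span_comp:
  assumes commute: "\<And>u v p. D u (D v p) = D v (D u p)" and D: "\<And>v. mpoly_linear (D v)"
    and "E \<in> multi_op_span D e"
  shows "(\<lambda>p. D v (E p)) \<in> multi_op_span D (Suc e)"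
proof -
  let ?s = "\<lambda>u. u + Poly_Mapping.single v (1::nat)"
  let ?d = "\<lambda>u. u - Poly_Mapping.single v (1::nat)"
  obtain c where c: "\<And>p. E p = (\<Sum>u\<in>{u. mdegree u = e}. Const (c u) * multi_op D u p)"
    using assms(3) unfolding multi_op_span_def by blast
  have "D v (E p) = (\<Sum>u\<in>{u. mdegree u = Suc e}.
      Const (if Poly_Mapping.lookup u v = 0 then 0 else c (?d u)) * multi_op D u p)" for p
  proof -
    have "D v (E p) = (\<Sum>u\<in>{u. mdegree u = e}. Const (c u) * multi_op D (?s u) p)"
      unfolding c mpoly_linear_sum[OF D] multi_op_add_single[of D, OF commute] ..
    also have "\<dots> = (\<Sum>u\<in>?s ` {u. mdegree u = e}. Const (c (?d u)) * multi_op D u p)"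
      by (subst sum.reindex) (auto simp: inj_on_def)
    also have "\<dots> = (\<Sum>u\<in>{u. mdegree u = Suc e}.
        Const (if Poly_Mapping.lookup u v = 0 then 0 else c (?d u)) * multi_op D u p)"
    \<comment> \<open>The exponents of degree \<open>Suc e\<close> missed by the shift are those
      without \<open>v\<close>, and they receive the default coefficient 0.\<close>
    proof (rule sum.mono_neutral_cong_left)
      show "\<forall>u\<in>{u. mdegree u = Suc e} - ?s ` {u. mdegree u = e}.
          Const (if Poly_Mapping.lookup u v = 0 then 0 else c (?d u)) * multi_op D u p = 0"
      proof
        fix u assume u: "u \<in> {u. mdegree u = Suc e} - ?s ` {u. mdegree u = e}"
        have "Poly_Mapping.lookup u v = 0"
        proof (rule ccontr)
          assume "Poly_Mapping.lookup u v \<noteq> 0"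
          then have eq: "u = ?s (?d u)" using monomial_diff_add_single by metis
          moreover have "mdegree (?d u) = e" using u arg_cong[OF eq, of mdegree]
            by (simp add: mdegree_add)
          ultimately show False using u by blast
        qed
        then show "Const (if Poly_Mapping.lookup u v = 0 then 0 else c (?d u)) * multi_op D u p = 0"
          by simp
      qed
    qed (auto simp: mdegree_add lookup_add finite_monomials)
    finally show ?thesis .
  qed
  then show ?thesis unfolding multi_op_span_def by (intro CollectI exI allI)
qed

text \<open>A linear substitution turns a monomial into a homogeneous polynomial of the same degree.
  Hence the derivatives of a fixed order in one family are constant combinations of those of the
  same order in the other.\<close>

lemma multi_op_change_of_operators:
  assumes commute: "\<And>u v p. D u (D v p) = D v (D u p)" and D: "\<And>v. mpoly_linear (D v)"
    and E: "\<And>u v p. E u (E v p) = E v (E u p)"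
    and "\<And>v p. E v p = (\<Sum>u\<in>UNIV. Const (a v u) * D u p)"
  shows "multi_op E t \<in> multi_op_span D (mdegree t)"
proof (induction t rule: monomial_induct)
  case zero
  have "{u. mdegree u = 0} = {0 :: 'a monomial}" by (auto simp: mdegree_eq_0_iff)
  then show ?case
    unfolding multi_op_span_def mdegree_eq_0_iff[THEN iffD2, OF refl]
    by (intro CollectI exI[of _ "\<lambda>_. 1"]) simp
next
  case (add t v)
  have "multi_op E (t + Poly_Mapping.single v 1) =
      (\<lambda>p. \<Sum>u\<in>UNIV. Const (a v u) * D u (multi_op E t p))"
    unfolding multi_op_add_single[of E, OF E, abs_def] assms(4) ..
  also have "\<dots> \<in> multi_op_span D (Suc (mdegree t))"
    by (intro multi_op_span_sum multi_op_span_scale multi_op_span_comp[OF commute D] add)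
  finally show ?case by (simp add: mdegree_add)
qed

lemma pderivatives_eq_multi_op:
  fixes t :: "'n::finite monomial" and p :: "('n + 'w, 'a::comm_semiring_1) mpoly"
  shows "pderivatives (\<Sum>i\<in>Poly_Mapping.keys t. Poly_Mapping.single (Inl i) (Poly_Mapping.lookup t i)) p
     = multi_op (\<lambda>i. pderivative (Inl i)) t p"
proof -
  let ?s = "\<Sum>i\<in>Poly_Mapping.keys t. Poly_Mapping.single (Inl i :: 'n + 'w) (Poly_Mapping.lookup t i)"
  have lookup: "Poly_Mapping.lookup ?s (Inl i) = Poly_Mapping.lookup t i" for i
    by (auto simp: lookup_sum lookup_single when_def in_keys_iff sum.delta)
  have lookup_Inr: "Poly_Mapping.lookup ?s (Inr i) = 0" for i
    by (simp add: lookup_sum lookup_single)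
  have keys: "Poly_Mapping.keys ?s = Inl ` Poly_Mapping.keys t"
  proof (rule Set.set_eqI)
    show "v \<in> Poly_Mapping.keys ?s \<longleftrightarrow> v \<in> Inl ` Poly_Mapping.keys t" for v
      by (cases v) (simp_all only: in_keys_iff[of _ ?s] lookup lookup_Inr, auto simp: in_keys_iff)
  qed
  interpret comp_fun_commute "\<lambda>v. pderivative (Inl v :: 'n + 'w) ^^ Poly_Mapping.lookup t v"
    by (rule comp_fun_commute_powers) (rule pderivative_commute)
  \<comment> \<open>A variable with exponent 0 contributes the identity, so the fold may be extended
    from the keys of \<open>t\<close> to all variables.\<close>
  have "Finite_Set.fold (\<lambda>v. pderivative (Inl v :: 'n + 'w) ^^ Poly_Mapping.lookup t v) p (A \<union> C) =
      Finite_Set.fold (\<lambda>v. pderivative (Inl v :: 'n + 'w) ^^ Poly_Mapping.lookup t v) p A"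
    if "finite C" "\<And>v. v \<in> C \<Longrightarrow> Poly_Mapping.lookup t v = 0" "A \<inter> C = {}" for A C
    using that by (induction C) auto
  from this[of "- Poly_Mapping.keys t" "Poly_Mapping.keys t"] show ?thesis
    unfolding pderivatives_def keys multi_op_def
    by (simp add: fold_image inj_on_def comp_def lookup in_keys_iff)
qed

section \<open>Bases adapted to a decreasing chain of subspaces\<close>

context vector_space
begin

text \<open>The basis grows from the small spaces to the large ones: induction on \<open>m\<close>
  applied to the chain shifted by one gives an independent set in \<open>U 1\<close>, which is then
  extended inside \<open>U 0\<close>.\<close>

lemma adapted_basis:
  assumes "\<And>j. U (Suc j) \<subseteq> U j" and "U 0 \<subseteq> span W" and "finite W"
  obtains S where "S \<subseteq> U 0" "independent S" "U 0 \<subseteq> span S"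
    "\<And>j. j \<le> m \<Longrightarrow> dim (U j) \<le> card (S \<inter> U j)"
proof -
  have "\<exists>S. S \<subseteq> U 0 \<and> independent S \<and> U 0 \<subseteq> span S \<and> (\<forall>j\<le>m. dim (U j) \<le> card (S \<inter> U j))"
    using assms(1,2)
  proof (induction m arbitrary: U)
    case 0
    obtain S where "S \<subseteq> U 0" "independent S" "U 0 \<subseteq> span S" "card S = dim (U 0)"
      by (rule basis_exists)
    then show ?case by (auto simp: Int_absorb2 intro!: exI[of _ S])
  next
    case (Suc m)
    have "\<exists>S. S \<subseteq> U (Suc 0) \<and> independent S \<and> U (Suc 0) \<subseteq> span S \<and>
        (\<forall>j\<le>m. dim (U (Suc j)) \<le> card (S \<inter> U (Suc j)))"
      by (rule Suc.IH) (use Suc.prems in blast)+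
    then obtain S' where S': "S' \<subseteq> U (Suc 0)" "independent S'"
      "\<And>j. j \<le> m \<Longrightarrow> dim (U (Suc j)) \<le> card (S' \<inter> U (Suc j))"
      by blast
    have "S' \<subseteq> U 0" using S'(1) Suc.prems(1) by blast
    then obtain S where S: "S' \<subseteq> S" "S \<subseteq> U 0" "independent S" "U 0 \<subseteq> span S"
      using maximal_independent_subset_extend[OF _ S'(2)] by blast
    have "S \<subseteq> span W" using S(2) Suc.prems(2) by blast
    \<comment> \<open>Finiteness is what makes \<open>card\<close> monotone when \<open>S'\<close>
      is enlarged to \<open>S\<close>.\<close>
    then have fin: "finite S" using independent_span_bound[OF assms(3) S(3)] by blast
    have "dim (U j) \<le> card (S \<inter> U j)" if "j \<le> Suc m" for j
    proof (cases j)
      case 0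
      have "card S = dim (U 0)" by (rule basis_card_eq_dim[OF S(2,4,3)])
      then show ?thesis using 0 S(2) by (simp add: Int_absorb2)
    next
      case (Suc i)
      have "card (S' \<inter> U j) \<le> card (S \<inter> U j)" using S(1) fin by (intro card_mono) auto
      then show ?thesis using S'(3)[of i] Suc that by simp
    qed
    then show ?case using S by blast
  qed
  then show thesis using that by blast
qed

lemma span_set_list:
  assumes "x \<in> span (set xs)"
  shows "\<exists>c. x = (\<Sum>q<length xs. scale (c q) (xs ! q))"
  using assms
proof (induction rule: span_induct_alt)
  case base
  then show ?case by (intro exI[of _ "\<lambda>_. 0"]) simp
next
  case (step a x y)
  obtain c where y: "y = (\<Sum>q<length xs. scale (c q) (xs ! q))" using step(2) by blast
  obtain q0 where q0: "q0 < length xs" "x = xs ! q0" using step(1) by (auto simp: in_set_conv_nth)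
  have "(\<Sum>q<length xs. scale (if q = q0 then a else 0) (xs ! q)) =
      (\<Sum>q<length xs. if q = q0 then scale a (xs ! q) else 0)"
    by (rule sum.cong) auto
  then have "scale a x = (\<Sum>q<length xs. scale (if q = q0 then a else 0) (xs ! q))"
    using q0 by simp
  then show ?case
    by (intro exI[of _ "\<lambda>q. (if q = q0 then a else 0) + c q"])
      (simp only: y scale_left_distrib sum.distrib)
qed

end


section \<open>The ideal of a point times projective space\<close>

text \<open>Differentiation in the \<open>Inl\<close> variables along row \<open>i\<close> of the
  constant matrix \<open>A\<close>; the \<open>Inr\<close> variables count as constants.\<close>

definition combined_op ::
  "('n::finite \<Rightarrow> 'n \<Rightarrow> 'a::comm_ring_1) \<Rightarrow> 'n \<Rightarrow> ('n + 'w, 'a) mpoly \<Rightarrow> ('n + 'w, 'a) mpoly" where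
  "combined_op A i p = (\<Sum>j\<in>UNIV. Const (A i j) * pderivative (Inl j) p)"

lemma derivation_combined_op: "derivation (combined_op A i)"
  unfolding derivation_def combined_op_def pderivative_add
    derivation_mult[OF derivation_pderivative]
  by (simp only: distrib_left sum.distrib sum_distrib_left sum_distrib_right ac_simps simp_thms)

lemma mpoly_linear_combined_op: "mpoly_linear (combined_op A i)"
  unfolding mpoly_linear_def combined_op_def
    mpoly_linear_add[OF mpoly_linear_pderivative] mpoly_linear_scale[OF mpoly_linear_pderivative]
  by (simp only: distrib_left sum.distrib sum_distrib_left ac_simps simp_thms)

lemma combined_op_commute: "combined_op A u (combined_op A v p) = combined_op A v (combined_op A u p)"
proof -
  have *: "combined_op A u (combined_op A v p) =
      (\<Sum>i\<in>UNIV. \<Sum>j\<in>UNIV. Const (A u i) * (Const (A v j) *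
        pderivative (Inl i) (pderivative (Inl j) p)))" for u v
    unfolding combined_op_def
    by (simp only: mpoly_linear_sum[OF mpoly_linear_pderivative] sum_distrib_left)
  show ?thesis
    unfolding *[of u v] *[of v u]
    by (subst sum.swap) (simp only: ac_simps pderivative_commute)
qed

text \<open>Replaces the coordinate derivation at \<open>i0\<close> by the derivation in the direction \<open>b\<close>.\<close>

definition direction_coeffs :: "('n \<Rightarrow> 'a::field) \<Rightarrow> 'n \<Rightarrow> 'n \<Rightarrow> 'n \<Rightarrow> 'a" where
  "direction_coeffs b i0 i j = (if i = i0 then b j else if i = j then 1 else 0)"

lemma combined_op_direction:
  "combined_op (direction_coeffs b i0) i0 p = (\<Sum>j\<in>UNIV. Const (b j) * pderivative (Inl j) p)"
  by (simp add: combined_op_def direction_coeffs_def)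

lemma combined_op_other:
  assumes "i \<noteq> i0"
  shows "combined_op (direction_coeffs b i0) i p = pderivative (Inl i) p"
proof -
  have "combined_op (direction_coeffs b i0) i p =
      (\<Sum>j\<in>UNIV. if j = i then pderivative (Inl j) p else 0)"
    unfolding combined_op_def by (rule sum.cong) (use assms in \<open>auto simp: direction_coeffs_def\<close>)
  then show ?thesis by simp
qed

text \<open>Inverts the change of derivations: the equation for the directional derivation is solved
  for the derivative at \<open>i0\<close>, which requires division by \<open>b i0\<close>.\<close>

lemma pderivative_eq_combined_ops:
  fixes b :: "'n::finite \<Rightarrow> 'a::field"
  assumes b: "b i0 \<noteq> 0"
  shows "\<exists>a. \<forall>v p. pderivative (Inl v :: 'n + 'w) p =
    (\<Sum>u\<in>UNIV. Const (a v u) * combined_op (direction_coeffs b i0) u p)"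
proof (intro exI allI)
  let ?a = "\<lambda>v u. if v = i0 then (if u = i0 then 1 / b i0 else - b u / b i0)
    else if u = v then 1 else 0"
  let ?D = "combined_op (direction_coeffs b i0)"
  fix v and p :: "('n + 'w, 'a) mpoly"
  show "pderivative (Inl v) p = (\<Sum>u\<in>UNIV. Const (?a v u) * ?D u p)"
  proof (cases "v = i0")
    case True
    let ?s = "\<Sum>u\<in>UNIV - {i0}. Const (b u / b i0) * pderivative (Inl u) p"
    have "(\<Sum>u\<in>UNIV - {i0}. Const (?a v u) * ?D u p) = - ?s"
      unfolding sum_negf[symmetric]
      by (rule sum.cong)
        (auto simp: True combined_op_other Const_def single_uminus)
    moreover have "Const (1 / b i0) * ?D i0 p = pderivative (Inl i0) p + ?s"
      unfolding combined_op_direction sum.remove[of UNIV i0, OF finite UNIV_I]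
      by (simp add: distrib_left sum_distrib_left b flip: mult.assoc Const_mult)
    ultimately show ?thesis
      unfolding sum.remove[of UNIV i0, OF finite UNIV_I] by (simp add: True)
  next
    case False
    have "(\<Sum>u\<in>UNIV. Const (?a v u) * ?D u p) = (\<Sum>u\<in>UNIV. if u = v then ?D u p else 0)"
      by (rule sum.cong) (use False in auto)
    then show ?thesis by (simp add: combined_op_other[OF False])
  qed
qed

text \<open>The number of derivations in \<open>u\<close> that may lower the order along the ideal.
  Those at \<open>i0\<close> are taken in the direction of the point and do not count.\<close>

definition degree_off :: "'n::finite \<Rightarrow> 'n monomial \<Rightarrow> nat" where
  "degree_off i0 u = (\<Sum>v\<in>UNIV - {i0}. Poly_Mapping.lookup u v)"

lemma degree_off_single:
  "degree_off i0 (u + Poly_Mapping.single v e) = degree_off i0 u + (if v = i0 then 0 else e)"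
  by (auto simp: degree_off_def lookup_add sum.distrib lookup_single when_def sum.delta)

lemma degree_off_le_mdegree: "degree_off i0 u \<le> mdegree u"
  by (simp add: degree_off_def mdegree_eq_sum_UNIV sum_mono2)

text \<open>The derivation sends \<open>a_var i\<close> to the constant \<open>b i\<close>, so a
  minor is sent to \<open>b i * b l - b l * b i = 0\<close>.\<close>

lemma direction_derivation_ideal:
  assumes "x \<in> ideal_power (point_times_space_ideal b) k"
  shows "combined_op (direction_coeffs b i0) i0 x \<in> ideal_power (point_times_space_ideal b) k"
  using assms unfolding point_times_space_ideal_def
proof (rule derivation_ideal_power_stable[OF derivation_combined_op, rotated])
  fix s :: "('a + 'a, 'b) mpoly"
  assume "s \<in> {Const (b i) * a_var l - Const (b l) * a_var i | i l. True}"
  then obtain i l where "s = Const (b i) * a_var l - Const (b l) * a_var i" by blast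
  \<comment> \<open>The minor is rewritten without subtraction because \<open>mpoly_linear\<close>
    speaks of sums.\<close>
  then have s: "s + Const (b l) * a_var i = Const (b i) * a_var l" by simp
  let ?D = "combined_op (direction_coeffs b i0) i0 :: ('a + 'a, 'b) mpoly \<Rightarrow> _"
  have D_a_var: "?D (a_var i) = Const (b i)" for i
  proof -
    have "?D (a_var i) = (\<Sum>j\<in>UNIV. if j = i then Const (b j) else 0)"
      unfolding combined_op_direction a_var_def
      by (rule sum.cong) (auto simp: pderivative_Var)
    then show ?thesis by simp
  qed
  note lin = mpoly_linear_combined_op[of "direction_coeffs b i0" i0]
  have "?D s + Const (b l) * Const (b i) = Const (b i) * Const (b l)"
    using arg_cong[OF s, of ?D]
    by (simp only: mpoly_linear_add[OF lin] mpoly_linear_scale[OF lin] D_a_var)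
  then have "?D s = 0" by (simp add: mult.commute)
  then show "?D s \<in> ideal_gen {Const (b i) * a_var l - Const (b l) * a_var i | i l. True}"
    by (simp add: ring_module.subspace_0[OF ideal_gen_ideal])
qed

lemma multi_op_ideal_power:
  assumes p: "p \<in> ideal_power (point_times_space_ideal b) j"
  shows "multi_op (combined_op (direction_coeffs b i0)) u p
    \<in> ideal_power (point_times_space_ideal b) (j - degree_off i0 u)"
proof (induction u rule: monomial_induct)
  case zero
  then show ?case using p by (simp add: degree_off_def)
next
  case (add u v)
  show ?case
  proof (cases "v = i0")
    case True
    then show ?thesis
      unfolding multi_op_add_single[of "combined_op _", OF combined_op_commute] degree_off_single
      using direction_derivation_ideal[OF add] by simp
  next
    case False
    then show ?thesis
      unfolding multi_op_add_single[of "combined_op _", OF combined_op_commute] degree_off_single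
      using derivation_ideal_power[OF derivation_combined_op add] by simp
  qed
qed

section \<open>Substitution into vanishing ideals\<close>

lemma subst_ideal_gen:
  assumes J: "ring_module.subspace J" and S: "\<And>s. s \<in> S \<Longrightarrow> subst q s \<in> J"
    and "f \<in> ideal_gen S"
  shows "subst q f \<in> J"
  using assms(3) unfolding ideal_gen_def
proof (induction rule: ring_module.span_induct_alt)
  case base
  then show ?case by (simp add: ring_module.subspace_0[OF J])
next
  case (step c x y)
  show ?case unfolding subst_add subst_mult
    by (rule ring_module.subspace_add[OF J ring_module.subspace_scale[OF J S[OF step(1)]] step(2)])
qed

lemma subst_vanishing_ideal:
  assumes "f \<in> vanishing_ideal Z" and "p \<in> Z"
  shows "subst (\<lambda>v. Const (p v)) f = (0 :: ('v, 'a::field) mpoly)"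
proof -
  \<comment> \<open>The zero ideal serves as the target ideal in
    \<open>subst_ideal_gen\<close>.\<close>
  have "subst (\<lambda>v. Const (p v)) f \<in> {0 :: ('v, 'a) mpoly}"
    using assms(1) unfolding vanishing_ideal_def
    by (rule subst_ideal_gen[rotated 2]) (auto simp: subst_Const_point assms(2))
  then show ?thesis by simp
qed

lemma subst_a_var_vanishing_ideal:
  assumes B: "proj_point B" and f: "f \<in> vanishing_ideal {B}"
  shows "subst a_var f \<in> point_times_space_ideal B"
  using f unfolding vanishing_ideal_def
proof (rule subst_ideal_gen[rotated 2])
  let ?J = "point_times_space_ideal B"
  show J: "ring_module.subspace ?J"
    by (simp add: point_times_space_ideal_def ideal_gen_ideal)
  obtain i0 where b: "B i0 \<noteq> 0" using B by (auto simp: proj_point_def)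
  fix f assume "f \<in> {f. (\<exists>e. homogeneous e f) \<and> (\<forall>p\<in>{B}. evaluate f p = 0)}"
  then obtain e where e: "homogeneous e f" and 0: "evaluate f B = 0" by auto
  \<comment> \<open>Modulo \<open>?J\<close> the vector \<open>b\<^sub>0 a\<close> is \<open>a\<^sub>0 b\<close>, so \<open>b\<^sub>0^e f(a) = a\<^sub>0^e f(b)\<close>.\<close>
  have cong: "Const (B i0) * a_var v - a_var i0 * Const (B v) \<in> ?J" for v
    unfolding point_times_space_ideal_def ideal_gen_def
    by (rule ring_module.span_base) (auto simp: mult.commute)
  have mono: "Const (B i0) ^ mdegree t * mono_at a_var t -
      a_var i0 ^ mdegree t * Const (mono_at B t) \<in> ?J" for t
    unfolding mono_at_scale[symmetric] mono_at_Const[symmetric]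
    unfolding mono_at_def
    by (intro prod_cong_mod_ideal[OF J] power_cong_mod_ideal[OF J] cong)
  \<comment> \<open>Homogeneity enters here: every exponent that occurs has degree \<open>e\<close>,
    so the common factor \<open>c ^ e\<close> can be distributed as
    \<open>c ^ mdegree t\<close>.\<close>
  have sum: "subst q f * c ^ e =
      (\<Sum>t\<in>Poly_Mapping.keys f. Const (Poly_Mapping.lookup f t) * (c ^ mdegree t * mono_at q t))"
    for q and c :: "('a + 'a, 'b) mpoly"
    unfolding subst_def sum_distrib_right
    by (rule sum.cong) (use e in \<open>auto simp: homogeneous_def\<close>)
  have "subst a_var f * Const (B i0) ^ e - subst (\<lambda>v. Const (B v)) f * a_var i0 ^ e \<in> ?J"
    unfolding sum sum_subtractf[symmetric] right_diff_distrib[symmetric]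
    using mono unfolding mono_at_Const
    by (intro ring_module.subspace_sum[OF J] ring_module.subspace_scale[OF J])
  \<comment> \<open>The subtracted term vanishes because \<open>f\<close> is zero at
    \<open>B\<close>. The remaining constant factor is invertible and is cancelled below.\<close>
  then have "subst a_var f * Const (B i0 ^ e) \<in> ?J"
    by (simp add: subst_Const_point 0 Const_power)
  then have "Const ((1 / B i0) ^ e) * (subst a_var f * Const (B i0 ^ e)) \<in> ?J"
    by (rule ring_module.subspace_scale[OF J])
  moreover have "Const ((1 / B i0) ^ e) * (subst a_var f * Const (B i0 ^ e)) =
      subst a_var f * Const ((1 / B i0) ^ e * B i0 ^ e)"
    by (simp only: Const_mult ac_simps)
  moreover have "(1 / B i0) ^ e * B i0 ^ e = 1"
    using b by (simp flip: power_mult_distrib)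
  ultimately show "subst a_var f \<in> ?J" by simp
qed

text \<open>Row \<open>i\<close> as an operator whose values on the column monomials are the matrix
  entries. This allows the columns to be indexed by any list of forms, and the parameter
  \<open>D\<close> allows other derivations.\<close>

definition interpolation_row ::
  "('n \<Rightarrow> ('n + 'n, 'a) mpoly \<Rightarrow> ('n + 'n, 'a) mpoly) \<Rightarrow> 'n monomial list \<Rightarrow>
   ('n::finite \<Rightarrow> 'a::field) list \<Rightarrow> nat \<Rightarrow> ('n, 'a) mpoly \<Rightarrow> ('n + 'n, 'a) mpoly" where
  "interpolation_row D ts P i f =
     (if i < length ts then multi_op D (ts ! i) (subst a_var f)
      else if i < length ts + length P then subst (\<lambda>v. Const ((P ! (i - length ts)) v)) f
      else subst x_var f)"

lemma mpoly_linear_interpolation_row: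
  assumes "\<And>u v p. D u (D v p) = D v (D u p)" and "\<And>v. mpoly_linear (D v)"
  shows "mpoly_linear (interpolation_row D ts P i)"
  unfolding interpolation_row_def
  using mpoly_linear_comp[OF multi_op_mpoly_linear[of D, OF assms] mpoly_linear_subst]
  by (cases "i < length ts"; cases "i < length ts + length P") (simp_all add: mpoly_linear_subst)

lemma interpolation_matrix_carrier:
  "interpolation_matrix ws ts P \<in> carrier_mat (length ts + length P + 1) (length ws)"
  unfolding interpolation_matrix_def Let_def mat_of_rows_list_def
  by (rule carrier_matI) simp_all

lemma interpolation_matrix_index:
  fixes P :: "('n::finite \<Rightarrow> 'a::field) list"
  assumes "i < length ts + length P + 1" and "j < length ws"
  shows "interpolation_matrix ws ts P $$ (i, j) =
    interpolation_row (\<lambda>v. pderivative (Inl v)) ts P i (Poly_Mapping.single (ws ! j) 1)"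
proof -
  consider "i < length ts" | k where "i = length ts + k" "k < length P" | "i = length ts + length P"
    using assms(1) by (metis add_Suc_right le_add_diff_inverse less_SucE nat_add_left_cancel_less
        not_le_imp_less semiring_norm(174) Suc_eq_plus1)
  then show ?thesis
    using assms
    by cases (simp_all add: interpolation_matrix_def Let_def mat_of_rows_list_def nth_append
        interpolation_row_def subst_single pderivatives_eq_multi_op)
qed


section \<open>Factorization and expansion of the interpolation matrix\<close>

text \<open>\<open>C\<close> expresses the coordinate derivative rows through the new derivations
  and is the identity on the other rows; \<open>E\<close> expresses the monomials through
  \<open>fs\<close>. In the determinant both contribute only ring factors, which respect ideal
  membership.\<close>

lemma interpolation_matrix_factorization:
  fixes P :: "('n::finite \<Rightarrow> 'a::field) list" and fs :: "('n, 'a) mpoly list"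
  assumes b: "b i0 \<noteq> 0"
    and ts: "distinct ts" "set ts = {t. mdegree t = e}"
    and N: "length ws = N" "length ts + length P + 1 = N" "length fs = N"
    and span: "\<And>t. t \<in> set ws \<Longrightarrow> Poly_Mapping.single t 1 \<in> mpoly.span (set fs)"
  obtains C E where "C \<in> carrier_mat N N" "E \<in> carrier_mat N N"
    "interpolation_matrix ws ts P = C * (mat N N (\<lambda>(i, q).
       interpolation_row (combined_op (direction_coeffs b i0)) ts P i (fs ! q)) * E)"
proof -
  let ?D = "combined_op (direction_coeffs b i0) :: 'n \<Rightarrow> ('n + 'n, 'a) mpoly \<Rightarrow> ('n + 'n, 'a) mpoly"
  let ?d = "\<lambda>v. pderivative (Inl v) :: ('n + 'n, 'a) mpoly \<Rightarrow> ('n + 'n, 'a) mpoly"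
  let ?T = "length ts"
  let ?M = "mat N N (\<lambda>(i, q). interpolation_row ?D ts P i (fs ! q))"
  note lin = mpoly_linear_interpolation_row[of ?D, OF combined_op_commute mpoly_linear_combined_op]
  obtain a where a: "\<And>v p. ?d v p = (\<Sum>u\<in>UNIV. Const (a v u) * ?D u p)"
    using pderivative_eq_combined_ops[where 'w = 'n, of b, OF b] by blast
  have "multi_op ?d t \<in> multi_op_span ?D (mdegree t)" for t
    by (rule multi_op_change_of_operators[OF combined_op_commute mpoly_linear_combined_op
          pderivative_commute a])
  then have "\<forall>t. \<exists>c. \<forall>p. multi_op ?d t p =
      (\<Sum>u\<in>{u. mdegree u = mdegree t}. Const (c u) * multi_op ?D u p)"
    unfolding multi_op_span_def by blast
  from choice[OF this] obtain c where c: "\<And>t p. multi_op ?d t p =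
      (\<Sum>u\<in>{u. mdegree u = mdegree t}. Const (c t u) * multi_op ?D u p)"
    by blast
  define C where "C = mat N N (\<lambda>(i, l).
    if i < ?T then (if l < ?T then Const (c (ts ! i) (ts ! l)) else 0)
    else if i = l then 1 else (0 :: ('n + 'n, 'a) mpoly))"
  have "\<forall>t\<in>set ws. \<exists>g. Poly_Mapping.single t 1 = (\<Sum>q<N. Const (g q) * fs ! q)"
    using mpoly.span_set_list[OF span] N(3) by auto
  from bchoice[OF this] obtain g where g: "\<And>t. t \<in> set ws \<Longrightarrow>
      Poly_Mapping.single t 1 = (\<Sum>q<N. Const (g t q) * fs ! q)"
    by blast
  define E where "E = mat N N (\<lambda>(q, j). Const (g (ws ! j) q) :: ('n + 'n, 'a) mpoly)"
  have row: "interpolation_row ?d ts P i f = (\<Sum>l<N. C $$ (i, l) * interpolation_row ?D ts P l f)"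
    if "i < N" for i f
  proof (cases "i < ?T")
    case True
    \<comment> \<open>All derivative rows have the same order \<open>e\<close>, so the operators
      needed in the expansion are exactly those listed in \<open>ts\<close>.\<close>
    have deg: "mdegree (ts ! i) = e" using True ts(2) nth_mem by blast
    have "(\<Sum>l<N. C $$ (i, l) * interpolation_row ?D ts P l f) =
        (\<Sum>l<?T. C $$ (i, l) * interpolation_row ?D ts P l f)"
      by (rule sum.mono_neutral_right) (use True that N in \<open>auto simp: C_def\<close>)
    also have "\<dots> = (\<Sum>l<?T. Const (c (ts ! i) (ts ! l)) * multi_op ?D (ts ! l) (subst a_var f))"
      by (rule sum.cong) (use True that N in \<open>auto simp: C_def interpolation_row_def\<close>)
    also have "\<dots> = (\<Sum>u\<in>set ts. Const (c (ts ! i) u) * multi_op ?D u (subst a_var f))"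
      by (rule sum.reindex_bij_betw[OF bij_betw_nth[OF ts(1) refl refl]])
    also have "\<dots> = interpolation_row ?d ts P i f"
      by (simp add: interpolation_row_def True c deg ts(2))
    finally show ?thesis ..
  next
    case False
    have "(\<Sum>l<N. C $$ (i, l) * interpolation_row ?D ts P l f) =
        (\<Sum>l<N. if l = i then interpolation_row ?D ts P l f else 0)"
      by (rule sum.cong) (use False that in \<open>auto simp: C_def\<close>)
    also have "\<dots> = interpolation_row ?D ts P i f" using that by simp
    finally show ?thesis using False by (simp add: interpolation_row_def)
  qed
  have "interpolation_matrix ws ts P = C * (?M * E)"
  proof (rule eq_matI)
    fix i j assume "i < dim_row (C * (?M * E))" "j < dim_col (C * (?M * E))"
    then have ij: "i < N" "j < N" by (simp_all add: C_def E_def)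
    have ME: "(?M * E) $$ (l, j) = interpolation_row ?D ts P l (Poly_Mapping.single (ws ! j) 1)"
      if "l < N" for l
    proof -
      have "(?M * E) $$ (l, j) =
          (\<Sum>q<N. interpolation_row ?D ts P l (fs ! q) * Const (g (ws ! j) q))"
        using that ij by (simp add: E_def scalar_prod_def lessThan_atLeast0)
      also have "\<dots> = (\<Sum>q<N. Const (g (ws ! j) q) * interpolation_row ?D ts P l (fs ! q))"
        by (simp only: mult.commute)
      also have "\<dots> = interpolation_row ?D ts P l (\<Sum>q<N. Const (g (ws ! j) q) * fs ! q)"
        by (rule mpoly_linear_sum[OF lin, symmetric])
      finally show ?thesis using g[of "ws ! j"] ij N(1) by simp
    qed
    have "(C * (?M * E)) $$ (i, j) = (\<Sum>l<N. C $$ (i, l) * (?M * E) $$ (l, j))"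
      using ij by (simp add: C_def E_def scalar_prod_def lessThan_atLeast0)
    also have "\<dots> = interpolation_row ?d ts P i (Poly_Mapping.single (ws ! j) 1)"
      unfolding row[OF ij(1)] by (rule sum.cong) (simp_all only: ME lessThan_iff)
    also have "\<dots> = interpolation_matrix ws ts P $$ (i, j)"
      using interpolation_matrix_index[of i ts P j ws] ij N by simp
    finally show "interpolation_matrix ws ts P $$ (i, j) = (C * (?M * E)) $$ (i, j)" ..
  qed (use interpolation_matrix_carrier[of ws ts P] N in \<open>auto simp: C_def E_def\<close>)
  then show thesis using that[of C E] by (simp add: C_def E_def)
qed

lemma card_degree_off_less:
  fixes ts :: "'n::finite monomial list"
  assumes "CARD('n) = n + 1" and "set ts = {t. mdegree t = m - 1}" and j: "1 \<le> j" "j \<le> m"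
  shows "(n + j - 1) choose n \<le> card {i. i < length ts \<and> degree_off i0 (ts ! i) < j}"
proof -
  let ?I = "{i. i < length ts \<and> degree_off i0 (ts ! i) < j}"
  \<comment> \<open>Multiplication by a power of the variable at \<open>i0\<close> embeds the
    monomials of degree \<open>j - 1\<close> into those of degree \<open>m - 1\<close> and leaves
    \<open>degree_off\<close>, which is at most \<open>j - 1\<close>, unchanged.\<close>
  let ?s = "\<lambda>v :: 'n monomial. v + Poly_Mapping.single i0 (m - j)"
  have "(n + j - 1) choose n = card {v :: 'n monomial. mdegree v = j - 1}"
    using card_monomials[OF assms(1), of "j - 1"] j by simp
  also have "\<dots> = card (?s ` {v. mdegree v = j - 1})"
    by (rule card_image[symmetric]) (auto simp: inj_on_def)
  also have "\<dots> \<le> card ((!) ts ` ?I)"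
  proof (rule card_mono)
    show "?s ` {v. mdegree v = j - 1} \<subseteq> (!) ts ` ?I"
    proof safe
      fix v :: "'n monomial" assume v: "mdegree v = j - 1"
      have "?s v \<in> set ts" using v j by (simp add: assms(2) mdegree_add)
      then obtain i where i: "i < length ts" "ts ! i = ?s v" by (auto simp: in_set_conv_nth)
      have "degree_off i0 (ts ! i) < j"
        using degree_off_le_mdegree[of i0 v] v j by (simp add: i degree_off_single)
      then show "?s v \<in> (!) ts ` ?I" using i by (auto intro: image_eqI[of _ _ i])
    qed
  qed simp
  also have "\<dots> \<le> card ?I" by (rule card_image_le) simp
  finally show ?thesis .
qed

lemma adapted_list:
  fixes U :: "nat \<Rightarrow> ('n, 'a::field) mpoly set"
  assumes "\<And>j. U (Suc j) \<subseteq> U j" and "U 0 \<subseteq> mpoly.span W" "finite W" "card W \<le> N"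
  obtains fs where "length fs = N" "U 0 \<subseteq> mpoly.span (set fs)"
    "\<And>j. j \<le> m \<Longrightarrow> mpoly.dim (U j) \<le> card {q. q < N \<and> fs ! q \<in> U j}"
proof -
  obtain S where S: "S \<subseteq> U 0" "mpoly.independent S" "U 0 \<subseteq> mpoly.span S"
    "\<And>j. j \<le> m \<Longrightarrow> mpoly.dim (U j) \<le> card (S \<inter> U j)"
    by (rule mpoly.adapted_basis[where U = U and m = m, OF assms(1-3)]) (rule that)
  have "S \<subseteq> mpoly.span W" using S(1) assms(2) by blast
  then have fin: "finite S" "card S \<le> N"
    using mpoly.independent_span_bound[OF assms(3) S(2)] assms(4) by auto
  obtain xs where xs: "set xs = S" "distinct xs" using finite_distinct_list[OF fin(1)] by blast
  \<comment> \<open>Zeros pad the basis to the number of columns; they leave the span unchanged and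
    can only increase the counts.\<close>
  define fs where "fs = xs @ replicate (N - card S) 0"
  have len: "length fs = N" using fin(2) distinct_card[OF xs(2)] xs(1) by (simp add: fs_def)
  have S_fs: "S \<subseteq> set fs" by (simp add: fs_def xs(1))
  have "mpoly.dim (U j) \<le> card {q. q < N \<and> fs ! q \<in> U j}" if "j \<le> m" for j
  proof -
    have "S \<inter> U j \<subseteq> (!) fs ` {q. q < N \<and> fs ! q \<in> U j}"
      using S_fs len by (auto simp: in_set_conv_nth image_iff subset_iff)
    then have "card (S \<inter> U j) \<le> card {q. q < N \<and> fs ! q \<in> U j}"
      by (rule surj_card_le[rotated]) simp
    then show ?thesis using S(4)[OF that] by simp
  qed
  moreover have "U 0 \<subseteq> mpoly.span (set fs)" using S(3) mpoly.span_mono[OF S_fs] by blast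
  ultimately show thesis using that len by blast
qed

lemma homogeneous_in_span:
  fixes f :: "('n, 'a::field) mpoly"
  assumes "homogeneous d f"
  shows "f \<in> mpoly.span ((\<lambda>t. Poly_Mapping.single t 1) ` {t. mdegree t = d})"
proof -
  have "(\<Sum>t\<in>Poly_Mapping.keys f. Const (Poly_Mapping.lookup f t) * Poly_Mapping.single t 1) \<in>
      mpoly.span ((\<lambda>t. Poly_Mapping.single t 1) ` {t. mdegree t = d})"
    using assms by (intro mpoly.span_sum mpoly.span_scale mpoly.span_base)
      (auto simp: homogeneous_def)
  then show ?thesis
    using mpoly_eq_sum_single[of f] by (simp flip: single_eq_Const_mult)
qed

lemma fat_forms_Suc_subset: "fat_forms d Z B (Suc j) \<subseteq> fat_forms d Z B j"
  using ideal_power_Suc_subset[of "vanishing_ideal {B}" j] unfolding fat_forms_def by blast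

text \<open>One term of the Leibniz expansion. The hypothesis on \<open>kk j\<close> says that the
  columns in \<open>fat_forms\<close> of order \<open>j\<close> outnumber the derivative rows with
  \<open>degree_off\<close> at least \<open>j\<close>, together with the last row, by at least
  \<open>kk j\<close>, unless \<open>kk j = 0\<close>.\<close>

lemma permuted_product_in_ideal_power:
  fixes P :: "('n::finite \<Rightarrow> 'a::field) list" and fs :: "('n, 'a) mpoly list"
  assumes B: "proj_point B" and pi: "\<pi> permutes {0..<N}"
    and N: "length ts + length P + 1 = N" and m: "m > 0"
    and k: "\<And>j. j \<in> {1..m} \<Longrightarrow>
      kk j + 1 + length ts \<le> card {q. q < N \<and> fs ! q \<in> fat_forms d (set P) B j}
        + card {i. i < length ts \<and> degree_off i0 (ts ! i) < j} \<or> kk j = 0"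
  shows "(\<Prod>i=0..<N. interpolation_row (combined_op (direction_coeffs B i0)) ts P i (fs ! \<pi> i))
    \<in> ideal_power (point_times_space_ideal B) (\<Sum>j=1..m. kk j)"
proof -
  let ?D = "combined_op (direction_coeffs B i0)"
  let ?J = "point_times_space_ideal B"
  let ?L = "fat_forms d (set P) B"
  let ?T = "length ts"
  let ?off = "\<lambda>i. degree_off i0 (ts ! i)"
  let ?A = "\<lambda>i. interpolation_row ?D ts P i (fs ! \<pi> i)"
  have anti: "?L j \<subseteq> ?L i" if "i \<le> j" for i j
    using that by (rule lift_Suc_antimono_le[of ?L, OF fat_forms_Suc_subset])
  show ?thesis
  \<comment> \<open>If a column vanishing on the points meets a point row, the entry and hence the
    product is 0.\<close>
  proof (cases "\<exists>i. ?T \<le> i \<and> i < ?T + length P \<and> fs ! \<pi> i \<in> ?L 1")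
    case True
    then obtain i where i: "?T \<le> i" "i < ?T + length P" "fs ! \<pi> i \<in> ?L 1" by blast
    have "P ! (i - ?T) \<in> set P" using i by simp
    moreover have "fs ! \<pi> i \<in> vanishing_ideal (set P)" using i(3) by (simp add: fat_forms_def)
    ultimately have "subst (\<lambda>v. Const ((P ! (i - ?T)) v)) (fs ! \<pi> i) = (0 :: ('n + 'n, 'a) mpoly)"
      by (intro subst_vanishing_ideal)
    then have "?A i = 0" using i by (simp add: interpolation_row_def)
    moreover have "i \<in> {0..<N}" using i N by simp
    ultimately have "(\<Prod>i=0..<N. ?A i) = 0" using prod_zero[of "{0..<N}" ?A] by blast
    then show ?thesis by (simp only: ring_module.subspace_0[OF ideal_power_ideal])
  next
    case False
    let ?X = "\<lambda>j. {i. i < ?T \<and> fs ! \<pi> i \<in> ?L j \<and> ?off i < j}"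
    \<comment> \<open>\<open>?e i\<close> counts the levels \<open>j\<close> at which row
      \<open>i\<close> is good. They all lie above \<open>?off i\<close> and at most at the largest
      level \<open>Max Y\<close>, so their number is bounded by \<open>Max Y - ?off i\<close>, an
      order that the entry attains.\<close>
    let ?e = "\<lambda>i. \<Sum>j=1..m. if i \<in> ?X j then 1 else (0::nat)"
    have "?A i \<in> ideal_power ?J (?e i)" for i
    proof (cases "\<exists>j\<in>{1..m}. i \<in> ?X j")
      case False
      then have "?e i = 0" by (auto intro!: sum.neutral)
      then show ?thesis by simp
    next
      case True
      define Y where "Y = {j\<in>{1..m}. i \<in> ?X j}"
      have Y: "finite Y" "Y \<noteq> {}" using True by (auto simp: Y_def)
      have max: "Max Y \<in> Y" using Max_in[OF Y] .
      have "?e i = card Y" by (simp add: Y_def sum.If_cases Int_def)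
      also have "\<dots> \<le> card {?off i<..Max Y}"
        by (rule card_mono) (use Max_ge[OF Y(1)] in \<open>auto simp: Y_def\<close>)
      finally have e: "?e i \<le> Max Y - ?off i" by simp
      have "fs ! \<pi> i \<in> ideal_power (vanishing_ideal {B}) (Max Y)"
        using max by (auto simp: Y_def fat_forms_def)
      then have "subst a_var (fs ! \<pi> i) \<in> ideal_power ?J (Max Y)"
        by (rule ideal_power_hom[where h = "subst a_var", OF subst_add subst_mult, rotated])
          (rule subst_a_var_vanishing_ideal[OF B])
      then have "multi_op ?D (ts ! i) (subst a_var (fs ! \<pi> i)) \<in> ideal_power ?J (Max Y - ?off i)"
        by (rule multi_op_ideal_power)
      moreover have "i < ?T" using max by (simp add: Y_def)
      ultimately show ?thesis
        using ideal_power_antimono[OF e, of ?J] by (auto simp: interpolation_row_def)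
    qed
    then have prod: "(\<Prod>i=0..<N. ?A i) \<in> ideal_power ?J (\<Sum>i=0..<N. ?e i)"
      by (rule prod_in_ideal_power)
    have "kk j \<le> card (?X j)" if j: "j \<in> {1..m}" for j
    proof (cases "kk j = 0")
      case False
      let ?low = "{i. i < ?T \<and> ?off i < j}" and ?high = "{i. i < ?T \<and> \<not> ?off i < j}"
      let ?Q = "{i. i < N \<and> fs ! \<pi> i \<in> ?L j}"
      \<comment> \<open>The permutation identifies the columns of level \<open>j\<close> with the
        rows they meet, so the count can be made on rows.\<close>
      have "\<pi> ` ?Q = {q. q < N \<and> fs ! q \<in> ?L j}"
        using permutes_in_image[OF pi] permutes_surj[OF pi] by (auto simp: image_iff) (metis surjD)
      then have Q: "card {q. q < N \<and> fs ! q \<in> ?L j} = card ?Q"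
        using card_image[of \<pi> ?Q] permutes_inj_on[OF pi, of ?Q] by simp
      \<comment> \<open>Point rows are excluded in this case, which leaves good derivative rows,
        derivative rows of too high order, and the single last row.\<close>
      have "?Q \<subseteq> ?X j \<union> ?high \<union> {?T + length P}"
      proof
        fix i assume i: "i \<in> ?Q"
        then have "fs ! \<pi> i \<in> ?L 1" using anti[of 1 j] j by auto
        then have "i < ?T \<or> i = ?T + length P"
          using \<open>\<not> (\<exists>i. ?T \<le> i \<and> i < ?T + length P \<and> fs ! \<pi> i \<in> ?L 1)\<close> i N
          by (metis (no_types, lifting) Suc_eq_plus1 less_antisym mem_Collect_eq not_le_imp_less)
        then show "i \<in> ?X j \<union> ?high \<union> {?T + length P}" using i by auto
      qed
      then have "card ?Q \<le> card (?X j \<union> ?high \<union> {?T + length P})" by (intro card_mono) auto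
      also have "\<dots> \<le> card (?X j) + card ?high + 1"
        using card_Un_le[of "?X j \<union> ?high" "{?T + length P}"] card_Un_le[of "?X j" ?high] by simp
      finally have "card ?Q \<le> card (?X j) + card ?high + 1" .
      moreover have "card ?low + card ?high = ?T"
      proof -
        have "?low \<union> ?high = {..<?T}" "?low \<inter> ?high = {}" by auto
        then show ?thesis using card_Un_disjoint[of ?low ?high] by simp
      qed
      ultimately show ?thesis using k[OF j] False Q by linarith
    qed simp
    \<comment> \<open>Double counting of the pairs of a level and a good row at that level.\<close>
    then have "(\<Sum>j=1..m. kk j) \<le> (\<Sum>j=1..m. card (?X j))" by (rule sum_mono)
    also have "\<dots> = (\<Sum>j=1..m. \<Sum>i=0..<N. if i \<in> ?X j then 1 else 0)"
    proof (rule sum.cong)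
      fix j
      have "{0..<N} \<inter> ?X j = ?X j" using N by auto
      then show "card (?X j) = (\<Sum>i=0..<N. if i \<in> ?X j then 1 else 0)"
        by (simp only: sum.If_cases finite_atLeastLessThan Collect_mem_eq) simp
    qed simp
    also have "\<dots> = (\<Sum>i=0..<N. ?e i)" by (rule sum.swap)
    finally show ?thesis using prod ideal_power_antimono[of _ _ ?J] by blast
  qed
qed

theorem theorem12:
  fixes P :: "('n::finite \<Rightarrow> 'a::field_char_0) list"
    and B :: "'n \<Rightarrow> 'a"
    and ws ts :: "'n monomial list"
    and n d m r k :: nat
    and kk :: "nat \<Rightarrow> nat"
    and F :: "('n + 'n, 'a) mpoly"
  assumes "CARD('n) = n + 1"
    and "d > 0" and "m > 0"
    and "length P = r"
    and "\<forall>p\<in>set P. proj_point p"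
    and "\<forall>i<r. \<forall>j<r. i \<noteq> j \<longrightarrow> \<not> proj_eq (P ! i) (P ! j)"
    and "proj_point B"
    and "(d + n) choose n = ((m + n - 1) choose n) + r + 1"
    and "distinct ws" and "set ws = {t. mdegree t = d}"
    and "distinct ts" and "set ts = {t. mdegree t = m - 1}"
    and "F = det (interpolation_matrix ws ts P)"
    and "\<forall>j\<in>{1..m}. int (kk j) =
           max 0 (int (mpoly.dim (fat_forms d (set P) B j))
                  - (int ((d + n) choose n) - int ((n + j - 1) choose n) - int r))"
    and "k = (\<Sum>j=1..m. kk j)"
  shows "F \<in> ideal_power (point_times_space_ideal B) k"
proof -
  let ?J = "point_times_space_ideal B"
  let ?N = "length ws"
  obtain i0 where i0: "B i0 \<noteq> 0" using assms(7) by (auto simp: proj_point_def)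
  have N: "?N = (d + n) choose n"
    using distinct_card[OF assms(9)] card_monomials[OF assms(1), of d]
    by (simp add: assms(10) add.commute)
  have T: "length ts = (m + n - 1) choose n"
    using distinct_card[OF assms(11)] card_monomials[OF assms(1), of "m - 1"] assms(3)
    by (simp add: assms(12) add.commute)
  have TN: "length ts + length P + 1 = ?N" using N T assms(4,8) by simp
  \<comment> \<open>At level 0 the chain takes all forms of degree \<open>d\<close>, whereas
    \<open>fat_forms\<close> would still impose vanishing on the points. Thus the adapted list spans
    every column monomial.\<close>
  define U where "U j = (if j = 0 then {f. homogeneous d f} else fat_forms d (set P) B j)" for j
  let ?W = "(\<lambda>t. Poly_Mapping.single t 1) ` set ws :: ('n, 'a) mpoly set"
  have U: "U (Suc j) \<subseteq> U j" for j
    using fat_forms_Suc_subset[of d "set P" B j] by (auto simp: U_def fat_forms_def)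
  have U0: "U 0 \<subseteq> mpoly.span ?W"
    using homogeneous_in_span by (auto simp: U_def assms(10))
  have W: "card ?W \<le> ?N"
    by (rule order.trans[OF card_image_le card_length]) simp
  obtain fs where fs: "length fs = ?N" "U 0 \<subseteq> mpoly.span (set fs)"
    "\<And>j. j \<le> m \<Longrightarrow> mpoly.dim (U j) \<le> card {q. q < ?N \<and> fs ! q \<in> U j}"
    by (rule adapted_list[where U = U and m = m, OF U U0 _ W]) (simp, rule that)
  have "Poly_Mapping.single t 1 \<in> mpoly.span (set fs)" if "t \<in> set ws" for t
    using that fs(2) by (auto simp: U_def homogeneous_def assms(10))
  then obtain C E where CE: "C \<in> carrier_mat ?N ?N" "E \<in> carrier_mat ?N ?N"
    "interpolation_matrix ws ts P = C * (mat ?N ?N (\<lambda>(i, q).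
       interpolation_row (combined_op (direction_coeffs B i0)) ts P i (fs ! q)) * E)"
    by (rule interpolation_matrix_factorization[where b = B and ws = ws, OF i0 assms(11,12) refl TN fs(1)])
  let ?M = "mat ?N ?N (\<lambda>(i, q).
       interpolation_row (combined_op (direction_coeffs B i0)) ts P i (fs ! q))"
  have "det ?M \<in> ideal_power ?J k"
  proof (rule det_in_ideal_power)
    fix p assume p: "p permutes {0..<?N}"
    \<comment> \<open>When \<open>kk j\<close> is positive, the maximum is its second argument; with
      the number of columns equal to \<open>length ts + length P + 1\<close>, the dimension bound
      and the row count give the inequality.\<close>
    have k: "kk j + 1 + length ts \<le> card {q. q < ?N \<and> fs ! q \<in> fat_forms d (set P) B j}
        + card {i. i < length ts \<and> degree_off i0 (ts ! i) < j} \<or> kk j = 0"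
      if j: "j \<in> {1..m}" for j
    proof -
      have "mpoly.dim (fat_forms d (set P) B j) \<le>
          card {q. q < ?N \<and> fs ! q \<in> fat_forms d (set P) B j}"
        using fs(3)[of j] j by (simp add: U_def)
      moreover have "(n + j - 1) choose n \<le> card {i. i < length ts \<and> degree_off i0 (ts ! i) < j}"
        using card_degree_off_less[OF assms(1,12)] j by simp
      moreover have "int (kk j) = max 0 (int (mpoly.dim (fat_forms d (set P) B j))
          - (int ?N - int ((n + j - 1) choose n) - int (length P)))"
        using assms(14) j N assms(4) by simp
      ultimately show ?thesis using TN by linarith
    qed
    have "(\<Prod>i=0..<?N. ?M $$ (i, p i)) = (\<Prod>i=0..<?N.
        interpolation_row (combined_op (direction_coeffs B i0)) ts P i (fs ! p i))"
      by (rule prod.cong) (use permutes_in_image[OF p] in auto)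
    then show "(\<Prod>i=0..<?N. ?M $$ (i, p i)) \<in> ideal_power ?J k"
      using permuted_product_in_ideal_power[where fs = fs, OF assms(7) p TN assms(3) k]
      by (simp add: assms(15))
  qed simp
  moreover have "F = det C * det E * det ?M"
    unfolding assms(13) CE(3)
      det_mult[OF CE(1) mult_carrier_mat[OF mat_carrier CE(2)]] det_mult[OF mat_carrier CE(2)]
    by (simp only: ac_simps)
  ultimately show ?thesis
    by (simp only: ring_module.subspace_scale[OF ideal_power_ideal])
qed

end
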